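(* Let $n\ge 2$ be an integer, let $m=2^{n-1}$, and let $\mathbf{d}_1,\mathbf{d}_2,\dots,\mathbf{d}_m\in\mathbb{F}_2^n$ be nonzero vectors (not necessarily distinct) with $\sum_{i=1}^m \mathbf{d}_i=\mathbf{0}$. Suppose that the number of distinct values among $\mathbf{d}_1,\dots,\mathbf{d}_m$ is at most $n-2\log_2 n-1$. Then $\mathbb{F}_2^n$ can be partitioned into pairwise disjoint pairs $\{\mathbf{a}_i,\mathbf{b}_i\}$ ($1\le i\le m$) such that $\mathbf{a}_i-\mathbf{b}_i=\mathbf{d}_i$ for every $1\le i\le m$.
   Context: $\mathbb{F}_2^n$ denotes the $n$-dimensional vector space over the two-element field $\mathbb{F}_2$. *)

theory Defs
  imports "HOL-Analysis.Analysis" "HOL-Library.Z2"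
begin

text \<open>
  The field with two elements is the library type \<open>bit\<close>; its \<open>n\<close>-dimensional
  vector space is \<open>bit ^ 'n\<close> for an index type with \<open>CARD('n) = n\<close>.
\<close>

end

theory Submission
  imports Defs
begin

text \<open>
  Let \<open>D\<close> be the set of the \<open>k\<close> difference values that occur, let \<open>c v\<close> be the number of
  times that \<open>v\<close> occurs, and let \<open>u\<close> be a most frequent value. The idea is to use \<open>u\<close> as
  filler: match every point \<open>x\<close> with \<open>x + u\<close>, except on small disjoint regions that are
  invariant under adding \<open>u\<close> and on which the other values are realized. The number of
  \<open>u\<close>-pairs then comes out right by itself.

  Two kinds of regions suffice. Two copies of \<open>v \<noteq> u\<close> fit on the four points
  \<open>x, x + u, x + v, x + u + v\<close>, and this handles the even part of all multiplicities
  (\<open>fits_even\<close>). What is left is one copy of each value in the set \<open>R\<close> of the values other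
  than \<open>u\<close> with odd multiplicity. Since the differences sum to zero and their number is even,
  the vectors \<open>u + v\<close> with \<open>v \<in> R\<close> sum to zero, so they split into minimal zero-sum sets. For
  such a set \<open>{w\<^sub>1, \<dots>, w\<^sub>t}\<close> consider the closed walk with partial sums
  \<open>P\<^sub>i = x + w\<^sub>1 + \<dots> + w\<^sub>i\<close>. Because \<open>P\<^sub>i\<close> and \<open>P\<^sub>i\<^sub>+\<^sub>1 + u\<close> differ by \<open>w\<^sub>i\<^sub>+\<^sub>1 + u\<close>, which is
  the value that \<open>w\<^sub>i\<^sub>+\<^sub>1\<close> stands for, these pairs realize each value of the set once and cover
  exactly the points \<open>P\<^sub>i\<close> and \<open>P\<^sub>i + u\<close> (\<open>fits_circuit\<close>). The pairs are disjoint provided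
  that the \<open>P\<^sub>i\<close> are distinct modulo \<open>u\<close>, and a minimal zero-sum set can always be ordered so
  that this holds (\<open>circuit_ordering\<close>).

  The regions are packed by reserving for each \<open>v\<close>, and for each minimal zero-sum set, a union
  of cosets of the span of \<open>D\<close>. A coset has at most \<open>2\<^sup>k\<close> points, so each of the at most
  \<open>2 (k - 1)\<close> reservations wastes at most about \<open>2\<^sup>k\<close> points (\<open>fits_add\<close>). The waste is filled by
  \<open>u\<close>-pairs, so everything fits as soon as \<open>(k - 1) 2\<^sup>k \<le> c u\<close>. As \<open>c u \<ge> m / k\<close>, this
  follows from \<open>k (k - 1) 2\<^sup>k \<le> m = 2\<^sup>n\<^sup>-\<^sup>1\<close>, which is what the bound on \<open>k\<close> gives.
\<close>

section \<open>Groups of exponent two\<close>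

class boolean_group = finite + ab_group_add +
  assumes add_self [simp]: "x + x = 0"
begin

lemma add_self_left [simp]: "x + (x + y) = y"
  by (simp flip: add.assoc)

lemma diff_conv_add: "x - y = x + y"
  by (metis add.right_neutral add_self_left diff_conv_add_uminus add.right_inverse)

lemma add_eq_0_iff_eq: "x + y = 0 \<longleftrightarrow> x = y"
  by (metis add_self add_self_left add.right_neutral)

end

instance bit :: boolean_group
proof
  have "(UNIV :: bit set) = {0, 1}" by (auto intro: bit.exhaust)
  then show "finite (UNIV :: bit set)" by (metis finite.emptyI finite.insertI)
qed simp

instance vec :: (boolean_group, finite) boolean_group
  by standard (simp add: vec_eq_iff)

lemma sum_sym_diff:
  fixes f :: "'i \<Rightarrow> 'a::boolean_group"
  assumes "finite A" "finite B"
  shows "sum f (sym_diff A B) = sum f A + sum f B"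
proof -
  have "sum f A = sum f (A - B) + sum f (A \<inter> B)"
    by (metis assms(1) sum.Int_Diff add.commute)
  moreover have "sum f B = sum f (B - A) + sum f (A \<inter> B)"
    by (metis assms(2) sum.Int_Diff add.commute Int_commute)
  moreover have "sum f (sym_diff A B) = sum f (A - B) + sum f (B - A)"
    using assms by (intro sum.union_disjoint) auto
  ultimately show ?thesis
    by (simp add: algebra_simps)
qed

section \<open>Translation-closed sets\<close>

text \<open>
  A set closed under adding elements of \<open>D\<close> is a union of cosets of the subgroup that \<open>D\<close>
  generates; this form makes the subgroup itself dispensable.
\<close>
definition closed_under :: "'a::boolean_group set \<Rightarrow> 'a::boolean_group set \<Rightarrow> bool" where
  "closed_under D U \<longleftrightarrow> (\<forall>x\<in>U. \<forall>h\<in>D. x + h \<in> U)"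

lemma closed_under_UNIV: "closed_under D UNIV"
  by (simp add: closed_under_def)

lemma closed_under_Diff:
  assumes "closed_under D U" "closed_under D V"
  shows "closed_under D (U - V)"
  unfolding closed_under_def
proof (intro ballI)
  fix x h assume *: "x \<in> U - V" "h \<in> D"
  have "x + h \<in> V \<Longrightarrow> (x + h) + h \<in> V"
    using assms * by (simp add: closed_under_def)
  with * assms show "x + h \<in> U - V"
    by (auto simp: closed_under_def add.assoc)
qed

lemma closed_under_Un:
  "closed_under D U \<Longrightarrow> closed_under D V \<Longrightarrow> closed_under D (U \<union> V)"
  by (auto simp: closed_under_def)

text \<open>
  The orbit of \<open>x\<close> consists of the points \<open>x + \<Sum>S\<close> with \<open>S \<subseteq> D\<close>: in exponent two, adding
  \<open>h\<close> turns \<open>S\<close> into its symmetric difference with \<open>{h}\<close>.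
\<close>
lemma small_closed_subset:
  fixes D U :: "'a::boolean_group set"
  assumes U: "closed_under D U" and x: "x \<in> U"
  obtains V where "closed_under D V" "x \<in> V" "V \<subseteq> U" "card V \<le> 2 ^ card D"
proof
  let ?V = "(\<lambda>S. x + \<Sum>S) ` Pow D"
  show "closed_under D ?V"
    unfolding closed_under_def
  proof (intro ballI)
    fix y h assume "y \<in> ?V" and h: "h \<in> D"
    then obtain S where S: "S \<subseteq> D" "y = x + \<Sum>S" by auto
    have "y + h = x + \<Sum>(sym_diff S {h})"
      using sum_sym_diff[of S "{h}" "\<lambda>x. x"] S by (simp add: add.assoc)
    moreover have "sym_diff S {h} \<in> Pow D" using S h by auto
    ultimately show "y + h \<in> ?V" by blast
  qed
  show "x \<in> ?V" by (rule image_eqI[of _ _ "{}"]) auto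
  have "x + \<Sum>S \<in> U" if "S \<subseteq> D" for S
    using finite[of S] that
  proof (induction S rule: finite_induct)
    case (insert h S)
    then have "x + \<Sum>S + h \<in> U" using U by (auto simp: closed_under_def)
    with insert.hyps show ?case by (simp add: algebra_simps)
  qed (use x in simp)
  then show "?V \<subseteq> U" by auto
  have "card ?V \<le> card (Pow D)" by (rule card_image_le) simp
  then show "card ?V \<le> 2 ^ card D" by (simp add: card_Pow)
qed

text \<open>
  Orbits are added one at a time until the size reaches \<open>s\<close>, so the excess is less than one orbit.
\<close>
lemma closed_subset_of_size:
  fixes D U :: "'a::boolean_group set"
  assumes U: "closed_under D U" and "s \<le> card U"
  obtains V where "closed_under D V" "V \<subseteq> U" "s \<le> card V" "card V \<le> s + 2 ^ card D"
proof -
  from \<open>s \<le> card U\<close>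
  have "\<exists>V. closed_under D V \<and> V \<subseteq> U \<and> s \<le> card V \<and> card V \<le> s + 2 ^ card D"
  proof (induction s)
    case 0
    show ?case by (intro exI[of _ "{}"]) (simp add: closed_under_def)
  next
    case (Suc s)
    then obtain V where V: "closed_under D V" "V \<subseteq> U" "s \<le> card V" "card V \<le> s + 2 ^ card D"
      by auto
    show ?case
    proof (cases "Suc s \<le> card V")
      case True
      with V show ?thesis by auto
    next
      case False
      then have cV: "card V = s" using V by simp
      have "V \<noteq> U" using cV Suc.prems by auto
      then obtain x where x: "x \<in> U - V" using V by auto
      obtain X where X: "closed_under D X" "x \<in> X" "X \<subseteq> U - V" "card X \<le> 2 ^ card D"
        using small_closed_subset[OF closed_under_Diff[OF U V(1)] x] by blast
      have "card (V \<union> X) = card V + card X" using X by (intro card_Un_disjoint) auto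
      moreover have "card X \<ge> 1" using X(2) by (auto simp: Suc_le_eq card_gt_0_iff)
      ultimately show ?thesis
        using V X cV by (intro exI[of _ "V \<union> X"]) (auto intro: closed_under_Un)
    qed
  qed
  then show thesis using that by blast
qed

section \<open>Matchings and the space they need\<close>

text \<open>
  A matching is encoded by the function \<open>g\<close> that gives the difference at each point: \<open>x\<close> is
  paired with \<open>x + g x\<close>. A pair is counted at both of its points, which explains the factor two.
  The filler \<open>u\<close> is exempt from the count, so that the same multiplicities can be realized on
  sets of various sizes.
\<close>
definition matching_on ::
    "'a::boolean_group \<Rightarrow> 'a::boolean_group set \<Rightarrow> ('a::boolean_group \<Rightarrow> nat) \<Rightarrow> ('a::boolean_group \<Rightarrow> 'a::boolean_group) \<Rightarrow> bool" where
  "matching_on u U f g \<longleftrightarrow>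
     (\<forall>x\<in>U. x + g x \<in> U \<and> g (x + g x) = g x) \<and>
     (\<forall>v. v \<noteq> u \<longrightarrow> card {x \<in> U. g x = v} = 2 * f v)"

lemma matching_on_Un:
  fixes U V :: "'a::boolean_group set"
  assumes g: "matching_on u U f g" and g': "matching_on u V f' g'" and disj: "U \<inter> V = {}"
  shows "matching_on u (U \<union> V) (\<lambda>v. f v + f' v) (\<lambda>x. if x \<in> U then g x else g' x)"
proof -
  let ?h = "\<lambda>x. if x \<in> U then g x else g' x"
  have "card {x \<in> U \<union> V. ?h x = v} = 2 * (f v + f' v)" if "v \<noteq> u" for v
  proof -
    have "{x \<in> U \<union> V. ?h x = v} = {x \<in> U. g x = v} \<union> {x \<in> V. g' x = v}"
      using disj by auto
    also have "card \<dots> = card {x \<in> U. g x = v} + card {x \<in> V. g' x = v}"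
      using disj by (intro card_Un_disjoint) auto
    finally show ?thesis using g g' that by (simp add: matching_on_def)
  qed
  then show ?thesis using g g' disj unfolding matching_on_def by auto
qed

text \<open>
  That \<open>s\<close> points are enough room, wherever they lie, to realize the multiplicities \<open>f\<close> for the
  values other than \<open>u\<close>. Asking this of all closed sets is what makes separate
  constructions combine.
\<close>
definition fits :: "'a::boolean_group set \<Rightarrow> 'a::boolean_group \<Rightarrow> ('a::boolean_group \<Rightarrow> nat) \<Rightarrow> nat \<Rightarrow> bool" where
  "fits D u f s \<longleftrightarrow> (\<forall>U. closed_under D U \<longrightarrow> s \<le> card U \<longrightarrow> (\<exists>g. matching_on u U f g))"

text \<open>
  Cut off a closed set with room for \<open>f\<close>; its size exceeds \<open>s\<close> by at most one orbit, so the
  rest, which is again closed, has room for \<open>f'\<close>.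
\<close>
lemma fits_add:
  fixes D :: "'a::boolean_group set"
  assumes f: "fits D u f s" and f': "fits D u f' s'"
  shows "fits D u (\<lambda>v. f v + f' v) (s + s' + 2 ^ card D)"
  unfolding fits_def
proof (intro allI impI)
  fix U :: "'a::boolean_group set"
  assume U: "closed_under D U" "s + s' + 2 ^ card D \<le> card U"
  then obtain V where V: "closed_under D V" "V \<subseteq> U" "s \<le> card V" "card V \<le> s + 2 ^ card D"
    using closed_subset_of_size[of D U s] by auto
  have "card (U - V) = card U - card V" using V by (simp add: card_Diff_subset)
  then have "s' \<le> card (U - V)" using U V by linarith
  then obtain g' where g': "matching_on u (U - V) f' g'"
    using f' closed_under_Diff[OF U(1) V(1)] by (auto simp: fits_def)
  obtain g where g: "matching_on u V f g" using f V by (auto simp: fits_def)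
  have "V \<union> (U - V) = U" using V by auto
  with matching_on_Un[OF g g'] show "\<exists>g. matching_on u U (\<lambda>v. f v + f' v) g" by auto
qed

lemma fits_zero:
  assumes "u \<in> D"
  shows "fits D u (\<lambda>_. 0) 0"
  unfolding fits_def
proof (intro allI impI)
  fix U assume "closed_under D U"
  with assms have "matching_on u U (\<lambda>_. 0) (\<lambda>_. u)"
    by (auto simp: matching_on_def closed_under_def)
  then show "\<exists>g. matching_on u U (\<lambda>_. 0) g" by blast
qed

section \<open>Realizing even multiplicities\<close>

lemma card_doubly_closed_subset:
  fixes U :: "'a::boolean_group set"
  assumes U: "closed_under {u, v} U" and "4 * q \<le> card U" and uv: "u \<noteq> 0" "v \<noteq> 0" "u \<noteq> v"
  obtains T where "closed_under {u, v} T" "T \<subseteq> U" "card T = 4 * q"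
proof -
  from \<open>4 * q \<le> card U\<close>
  have "\<exists>T. closed_under {u, v} T \<and> T \<subseteq> U \<and> card T = 4 * q"
  proof (induction q)
    case 0
    show ?case by (intro exI[of _ "{}"]) (simp add: closed_under_def)
  next
    case (Suc q)
    then obtain T where T: "closed_under {u, v} T" "T \<subseteq> U" "card T = 4 * q" by auto
    have "T \<noteq> U" using T(3) Suc.prems by auto
    then obtain x where x: "x \<in> U - T" using T by auto
    let ?X = "{x, x + u, x + v, x + u + v}"
    have cl: "closed_under {u, v} (U - T)" using U T by (intro closed_under_Diff)
    have sub: "?X \<subseteq> U - T" using cl x by (auto simp: closed_under_def)
    have X: "closed_under {u, v} ?X" by (auto simp: closed_under_def algebra_simps)
    have "u + v \<noteq> 0" using uv add_eq_0_iff_eq by blast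
    then have "card ?X = 4" using uv by (auto simp: add.assoc card_insert_if)
    moreover have "card (T \<union> ?X) = card T + card ?X" using sub by (intro card_Un_disjoint) auto
    ultimately show ?case
      using T sub closed_under_Un[OF T(1) X] by (intro exI[of _ "T \<union> ?X"]) simp
  qed
  then show thesis using that by blast
qed

lemma fits_even:
  fixes D :: "'a::boolean_group set"
  assumes "u \<in> D" "v \<in> D" "u \<noteq> 0" "v \<noteq> 0" "u \<noteq> v"
  shows "fits D u (\<lambda>w. if w = v then 2 * q else 0) (4 * q)"
  unfolding fits_def
proof (intro allI impI)
  fix U :: "'a::boolean_group set"
  assume U: "closed_under D U" "4 * q \<le> card U"
  then have U': "closed_under {u, v} U" using assms by (auto simp: closed_under_def)
  obtain T where T: "closed_under {u, v} T" "T \<subseteq> U" "card T = 4 * q"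
    using card_doubly_closed_subset[OF U' U(2) assms(3-5)] .
  let ?g = "\<lambda>x. if x \<in> T then v else u"
  have "closed_under {u, v} (U - T)" using U' T by (intro closed_under_Diff)
  then have "\<forall>x\<in>U. x + ?g x \<in> U \<and> ?g (x + ?g x) = ?g x"
    using T by (auto simp: closed_under_def)
  moreover have "{x \<in> U. ?g x = w} = (if w = v then T else {})" if "w \<noteq> u" for w
    using that T(2) assms by auto
  ultimately have "matching_on u U (\<lambda>w. if w = v then 2 * q else 0) ?g"
    using T(3) by (simp add: matching_on_def)
  then show "\<exists>g. matching_on u U (\<lambda>w. if w = v then 2 * q else 0) g" by blast
qed

section \<open>Realizing a minimal zero-sum set\<close>

text \<open>
  Prescribed disjoint pairs extend to a matching by filling with \<open>u\<close>-pairs, provided that the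
  points they cover, and hence the remaining ones, are closed under adding \<open>u\<close>.
\<close>
lemma matching_on_pairs:
  fixes U :: "'a::boolean_group set" and a :: "'i \<Rightarrow> 'a::boolean_group"
  defines "b \<equiv> \<lambda>val i. a i + val i"
  assumes U: "closed_under {u} U" and sub: "a ` I \<union> b val ` I \<subseteq> U"
    and injs: "inj_on a I" "inj_on (b val) I" "inj_on val I" and disj: "a ` I \<inter> b val ` I = {}"
    and cl: "closed_under {u} (a ` I \<union> b val ` I)"
    and u: "u \<notin> val ` I"
  shows "\<exists>g. matching_on u U (\<lambda>v. if v \<in> val ` I then 1 else 0) g"
proof -
  let ?X = "a ` I \<union> b val ` I"
  define g where "g x = (if x \<in> a ` I then val (inv_into I a x)
                         else if x \<in> b val ` I then val (inv_into I (b val) x) else u)" for x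
  have ga: "g (a i) = val i" if "i \<in> I" for i
    using that injs by (simp add: g_def)
  have gb: "g (b val i) = val i" if "i \<in> I" for i
    using that injs disj by (auto simp: g_def)
  have gn: "g x = u" if "x \<notin> ?X" for x
    using that by (simp add: g_def)
  have "x + g x \<in> U \<and> g (x + g x) = g x" if "x \<in> U" for x
  proof (cases "x \<in> ?X")
    case True
    then obtain i where i: "i \<in> I" "x = a i \<or> x = b val i" by auto
    have "a i + val i = b val i" "b val i + val i = a i" by (simp_all add: b_def add.assoc)
    then show ?thesis using i ga gb sub by auto
  next
    case False
    have "closed_under {u} (U - ?X)" using U cl by (rule closed_under_Diff)
    then show ?thesis using that False gn by (auto simp: closed_under_def)
  qed
  moreover have "card {x \<in> U. g x = v} = 2 * (if v \<in> val ` I then 1 else 0)" if v: "v \<noteq> u" for v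
  proof (cases "v \<in> val ` I")
    case True
    then obtain i where i: "i \<in> I" "v = val i" by auto
    have "{x \<in> U. g x = v} = {a i, b val i}"
    proof (intro equalityI subsetI)
      fix x assume x: "x \<in> {x \<in> U. g x = v}"
      then have "x \<in> ?X" using gn v by fastforce
      then obtain j where j: "j \<in> I" "x = a j \<or> x = b val j" by auto
      then have "val j = val i" using x i ga gb by auto
      then have "j = i" using injs i j by (auto dest: inj_onD)
      with j show "x \<in> {a i, b val i}" by auto
    qed (use i ga gb sub in auto)
    moreover have "a i \<noteq> b val i" using i disj by auto
    ultimately show ?thesis using True by simp
  next
    case False
    then have "{x \<in> U. g x = v} = {}" using v by (auto simp: g_def inv_into_into)
    with False show ?thesis by simp
  qed
  ultimately have "matching_on u U (\<lambda>v. if v \<in> val ` I then 1 else 0) g"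
    by (simp add: matching_on_def)
  then show ?thesis by blast
qed

text \<open>
  These are the circuits of the binary matroid formed by the elements of the group.
\<close>
definition zero_sum_circuit :: "'a::boolean_group set \<Rightarrow> bool" where
  "zero_sum_circuit W \<longleftrightarrow> W \<noteq> {} \<and> \<Sum>W = 0 \<and> (\<forall>S. S \<subset> W \<longrightarrow> S \<noteq> {} \<longrightarrow> \<Sum>S \<noteq> 0)"

lemma zero_sum_has_circuit:
  fixes W :: "'a::boolean_group set"
  assumes "W \<noteq> {}" "\<Sum>W = 0"
  obtains C where "C \<subseteq> W" "zero_sum_circuit C"
proof -
  have "\<exists>C\<subseteq>W. zero_sum_circuit C"
    using finite[of W] assms
  proof (induction W rule: finite_psubset_induct)
    case (psubset W)
    show ?case
    proof (cases "zero_sum_circuit W")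
      case False
      then obtain S where "S \<subset> W" "S \<noteq> {}" "\<Sum>S = 0"
        using psubset.prems by (auto simp: zero_sum_circuit_def)
      then show ?thesis using psubset.IH[of S] by blast
    qed blast
  qed
  then show thesis using that by blast
qed

text \<open>
  The symmetric difference of two subsets with sum \<open>u\<close> has sum zero, so by minimality it is
  empty or everything. Hence at most one complementary pair of subsets has sum \<open>u\<close>.
\<close>
lemma circuit_half:
  fixes W :: "'a::boolean_group set"
  assumes W: "zero_sum_circuit W" and u: "u \<noteq> 0" and A: "A \<subseteq> W" "\<Sum>A = u"
    and B: "B \<subseteq> W" "\<Sum>B = u"
  shows "B = A \<or> B = W - A"
proof -
  have "\<Sum>(sym_diff A B) = 0"
    using sum_sym_diff[of A B "\<lambda>x. x"] A B by simp
  moreover have "sym_diff A B \<subseteq> W" using A B by auto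
  ultimately have "sym_diff A B = {} \<or> sym_diff A B = W"
    using W unfolding zero_sum_circuit_def by blast
  then show ?thesis using A B by blast
qed

text \<open>
  In any ordering, an interval that omits the last element is a proper subset, so its sum is
  nonzero by minimality. Sum \<open>u\<close> can occur only if the interval is one of two complementary
  sets \<open>A\<close> and \<open>B\<close>, and both of these have at least two elements because \<open>u \<noteq> 0\<close> and
  \<open>u \<notin> W\<close>. Let the ordering start with an element of \<open>A\<close> followed by one of \<open>B\<close>, and end
  with another element of \<open>B\<close>. Then no interval equals \<open>A\<close>, since it would consist of the first
  element only, and none that omits the last element equals \<open>B\<close>.
\<close>
lemma circuit_ordering:
  fixes W :: "'a::boolean_group set"
  assumes W: "zero_sum_circuit W" and u: "u \<noteq> 0" "u \<notin> W"
  obtains xs where "distinct xs" "set xs = W"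
    "\<And>i j. i < j \<Longrightarrow> j < length xs \<Longrightarrow> (\<Sum>l=i..<j. xs ! l) \<notin> {0, u}"
proof -
  have interval: "(\<Sum>l=i..<j. xs ! l) = \<Sum>((!) xs ` {i..<j})"
    and proper: "(!) xs ` {i..<j} \<subset> W" "(!) xs ` {i..<j} \<noteq> {}"
    if xs: "distinct xs" "set xs = W" and ij: "i < j" "j < length xs" for xs i j
  proof -
    have inj: "inj_on ((!) xs) {..<length xs}"
      using xs by (intro inj_on_nth) auto
    show "(\<Sum>l=i..<j. xs ! l) = \<Sum>((!) xs ` {i..<j})"
      using inj_on_subset[OF inj, of "{i..<j}"] ij by (simp add: sum.reindex subset_iff)
    have "xs ! j \<notin> (!) xs ` {i..<j}"
      using xs(1) ij by (auto simp: nth_eq_iff_index_eq)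
    then show "(!) xs ` {i..<j} \<subset> W" using xs(2) ij by force
    show "(!) xs ` {i..<j} \<noteq> {}" using ij by simp
  qed
  show thesis
  proof (cases "\<exists>A\<subseteq>W. \<Sum>A = u")
    case False
    obtain xs where xs: "distinct xs" "set xs = W"
      using finite_distinct_list[OF finite[of W]] by auto
    show thesis
    proof (rule that[OF xs])
      fix i j assume "i < j" "j < length xs"
      then show "(\<Sum>l=i..<j. xs ! l) \<notin> {0, u}"
        using proper[OF xs] interval[OF xs] False W unfolding zero_sum_circuit_def
        by (metis insertE psubset_imp_subset singletonD)
    qed
  next
    case True
    then obtain A where A: "A \<subseteq> W" "\<Sum>A = u" by auto
    define B where "B = W - A"
    have B: "B \<subseteq> W" "\<Sum>B = u"
      using W A sum_diff[of W A "\<lambda>x. x"] by (auto simp: B_def zero_sum_circuit_def diff_conv_add)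
    have two: "\<exists>x y. x \<in> S \<and> y \<in> S \<and> x \<noteq> y" if "S \<subseteq> W" "\<Sum>S = u" for S
    proof (rule ccontr)
      assume *: "\<not> ?thesis"
      have "S \<noteq> {}" using that u by auto
      then obtain x where x: "x \<in> S" by auto
      with * have "S = {x}" by auto
      with that u show False by auto
    qed
    obtain a a' where a: "a \<in> A" "a' \<in> A" "a \<noteq> a'" using two[OF A] by auto
    obtain b b' where b: "b \<in> B" "b' \<in> B" "b \<noteq> b'" using two[OF B] by auto
    obtain ys where ys: "distinct ys" "set ys = W - {a, b, b'}"
      using finite_distinct_list[OF finite[of "W - {a, b, b'}"]] by auto
    define xs where "xs = a # b # ys @ [b']"
    have xs: "distinct xs" "set xs = W"
      using ys a b A B by (auto simp: xs_def B_def)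
    have nth: "xs ! 0 = a" "xs ! 1 = b" "xs ! (length xs - 1) = b'" "length xs \<ge> 3"
      by (auto simp: xs_def nth_append)
    show thesis
    proof (rule that[OF xs])
      fix i j assume ij: "i < j" "j < length xs"
      let ?S = "(!) xs ` {i..<j}"
      have idx: "l \<in> {i..<j}" if "xs ! l \<in> ?S" "l < length xs" for l
        using that xs(1) ij by (auto simp: nth_eq_iff_index_eq)
      have "?S \<noteq> A"
      proof
        assume S: "?S = A"
        have "0 \<in> {i..<j}" by (rule idx) (use S a nth in auto)
        moreover have "1 \<notin> {i..<j}" using S b nth by (force simp: B_def)
        ultimately have "i = 0" "j = 1" using ij by auto
        with S a show False by auto
      qed
      moreover have "?S \<noteq> B"
      proof
        assume S: "?S = B"
        have "length xs - 1 \<in> {i..<j}" by (rule idx) (use S b nth in auto)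
        with ij show False by auto
      qed
      ultimately have "\<Sum>?S \<noteq> u"
        using circuit_half[OF W u(1) A, of ?S] proper[OF xs ij] by (auto simp: B_def)
      moreover have "\<Sum>?S \<noteq> 0"
        using W proper[OF xs ij] by (auto simp: zero_sum_circuit_def)
      ultimately show "(\<Sum>l=i..<j. xs ! l) \<notin> {0, u}"
        using interval[OF xs ij] by auto
    qed
  qed
qed

text \<open>
  The closed walk \<open>P\<close> takes the steps \<open>u + v\<close>, \<open>v \<in> C\<close>, in an order given by
  \<open>circuit_ordering\<close>. Matching \<open>P i\<close> with \<open>P (i + 1) + u\<close> uses the difference \<open>v\<close> belonging to
  step \<open>i\<close>, and since the walk closes up, the points \<open>P i + u\<close> are all used too.
  A single orbit contains the whole walk, so any nonempty closed set has room for it.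
\<close>
lemma fits_circuit:
  fixes D :: "'a::boolean_group set"
  assumes C: "C \<subseteq> D - {u}" and D: "u \<in> D" "0 \<notin> D" and circ: "zero_sum_circuit ((+) u ` C)"
  shows "fits D u (\<lambda>v. if v \<in> C then 1 else 0) 1"
  unfolding fits_def
proof (intro allI impI)
  fix U :: "'a set"
  assume U: "closed_under D U" "1 \<le> card U"
  then obtain x0 where x0: "x0 \<in> U" by fastforce
  have u: "u \<noteq> 0" using D by auto
  have "u \<notin> (+) u ` C"
  proof
    assume "u \<in> (+) u ` C"
    then obtain v where "v \<in> C" "u = u + v" by auto
    then show False using C D by auto
  qed
  then obtain xs where xs: "distinct xs" "set xs = (+) u ` C"
    and ord: "\<And>i j. i < j \<Longrightarrow> j < length xs \<Longrightarrow> (\<Sum>l=i..<j. xs ! l) \<notin> {0, u}"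
    using circuit_ordering[OF circ u] by blast
  define t where "t = length xs"
  have t: "t > 0" using circ xs by (auto simp: zero_sum_circuit_def t_def)
  define P where "P i = x0 + (\<Sum>l<i. xs ! l)" for i
  define val where "val i = xs ! i + u" for i
  have PS: "P (Suc i) = P i + xs ! i" for i by (simp add: P_def add.assoc)
  have Pt: "P t = P 0"
    using circ sum.distinct_set_conv_list[OF xs(1), of "\<lambda>x. x"] xs
    by (simp add: P_def t_def zero_sum_circuit_def sum_list_sum_nth atLeast0LessThan)
  have Pij: "P i + P j \<notin> {0, u}" if "i < j" "j < t" for i j
  proof -
    have "(\<Sum>l<j. xs ! l) = (\<Sum>l<i. xs ! l) + (\<Sum>l=i..<j. xs ! l)"
      using that sum.atLeastLessThan_concat[of 0 i j "\<lambda>l. xs ! l"] by (simp add: atLeast0LessThan)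
    then have "P i + P j = (\<Sum>l=i..<j. xs ! l)"
      by (simp add: P_def algebra_simps)
    with ord that show ?thesis by (simp add: t_def)
  qed
  have P_distinct: "P i + P j \<notin> {0, u}" if "i \<noteq> j" "i < t" "j < t" for i j
    using that Pij[of i j] Pij[of j i] by (cases i j rule: linorder_cases) (auto simp: add.commute)
  have P_ne_u: "P i \<noteq> P j + u" if "i < t" "j < t" for i j
  proof
    assume eq: "P i = P j + u"
    then have "P i + P j = u" by (simp add: algebra_simps)
    then show False using P_distinct[of i j] that u by (cases "i = j") auto
  qed
  have P_inj: "i = j" if "P i = P j" "i < t" "j < t" for i j
    using P_distinct[of i j] that by auto
  \<comment> \<open>successor and predecessor along the closed walk, with indices below \<open>t\<close>\<close>
  define suc where "suc i = (if Suc i = t then 0 else Suc i)" for i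
  define pre where "pre i = (if i = 0 then t - 1 else i - 1)" for i
  have suc: "suc i < t" "P (Suc i) = P (suc i)" if "i < t" for i
    using that t Pt by (auto simp: suc_def)
  have pre: "pre i < t" "suc (pre i) = i" if "i < t" for i
    using that t by (auto simp: suc_def pre_def)
  have b: "P i + val i = P (suc i) + u" if "i < t" for i
    using suc[OF that] PS[of i] by (simp add: val_def add.assoc)
  have val_C: "val ` {..<t} = C"
  proof -
    have "val ` {..<t} = (\<lambda>w. w + u) ` set xs"
      by (auto simp: val_def t_def in_set_conv_nth image_iff)
    also have "\<dots> = C" by (auto simp: xs(2) image_image algebra_simps)
    finally show ?thesis .
  qed
  have P_in: "P i \<in> U" if "i \<le> t" for i
    using that
  proof (induction i)
    case 0
    show ?case using x0 by (simp add: P_def)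
  next
    case (Suc i)
    then have "val i \<in> val ` {..<t}" by auto
    then have "val i \<in> D" using val_C C by auto
    with Suc U D have "P i + val i + u \<in> U" by (auto simp: closed_under_def)
    then show ?case by (simp add: PS val_def add.assoc)
  qed
  have "\<exists>g. matching_on u U (\<lambda>v. if v \<in> val ` {..<t} then 1 else 0) g"
  proof (rule matching_on_pairs[where a = P])
    show "closed_under {u} U" using U D by (auto simp: closed_under_def)
    have P_u_in: "P i + u \<in> U" if "i < t" for i
      using P_in[of i] that U D by (auto simp: closed_under_def)
    show "P ` {..<t} \<union> (\<lambda>i. P i + val i) ` {..<t} \<subseteq> U"
      using P_in b suc P_u_in by auto
    show "inj_on P {..<t}" using P_inj by (auto intro: inj_onI)
    show "inj_on (\<lambda>i. P i + val i) {..<t}"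
    proof (rule inj_onI)
      fix i j assume ij: "i \<in> {..<t}" "j \<in> {..<t}" "P i + val i = P j + val j"
      then have "suc i = suc j" using b suc P_inj by auto
      then show "i = j" using ij by (auto simp: suc_def split: if_splits)
    qed
    show "inj_on val {..<t}"
      using xs(1) by (auto simp: val_def t_def inj_on_def nth_eq_iff_index_eq)
    show "P ` {..<t} \<inter> (\<lambda>i. P i + val i) ` {..<t} = {}"
      using b suc P_ne_u by auto
    show "u \<notin> val ` {..<t}" using val_C C by auto
    have "P i + u \<in> (\<lambda>i. P i + val i) ` {..<t}" if "i < t" for i
      using b[of "pre i"] pre[OF that] by (auto intro!: image_eqI[of _ _ "pre i"])
    moreover have "P i + val i + u \<in> P ` {..<t}" if "i < t" for i
      using b[OF that] suc[OF that] by (auto simp: add.assoc)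
    ultimately show "closed_under {u} (P ` {..<t} \<union> (\<lambda>i. P i + val i) ` {..<t})"
      by (auto simp: closed_under_def)
  qed
  then show "\<exists>g. matching_on u U (\<lambda>v. if v \<in> C then 1 else 0) g"
    by (simp add: val_C)
qed

section \<open>Realizing all multiplicities\<close>

text \<open>
  Minimal zero-sum sets are split off one by one. Each of them needs one point and wastes at
  most one orbit; bounding their number by \<open>card R\<close> is crude but affordable.
\<close>
lemma fits_zero_sum:
  fixes D :: "'a::boolean_group set"
  assumes D: "u \<in> D" "0 \<notin> D" and "R \<subseteq> D - {u}" "\<Sum>((+) u ` R) = 0"
  shows "fits D u (\<lambda>v. if v \<in> R then 1 else 0) (card R * (2 ^ card D + 1))"
  using finite[of R] assms(3,4)
proof (induction R rule: finite_psubset_induct)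
  case (psubset R)
  show ?case
  proof (cases "R = {}")
    case True
    then show ?thesis using fits_zero[OF D(1)] by simp
  next
    case False
    then have "(+) u ` R \<noteq> {}" by simp
    then obtain W where W: "W \<subseteq> (+) u ` R" "zero_sum_circuit W"
      by (rule zero_sum_has_circuit[OF _ psubset.prems(2)])
    then obtain C where C: "C \<subseteq> R" "W = (+) u ` C" by (meson subset_imageE)
    have inj: "inj_on ((+) u) R" by (simp add: inj_on_def)
    have "(+) u ` (R - C) = (+) u ` R - W"
      using inj_on_image_set_diff[OF inj, of R C] C by simp
    then have "\<Sum>((+) u ` (R - C)) = 0"
      using W psubset.prems by (simp add: sum_diff zero_sum_circuit_def)
    moreover have "C \<noteq> {}" using W C by (auto simp: zero_sum_circuit_def)
    moreover have "R - C \<subset> R" "R - C \<subseteq> D - {u}"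
      using \<open>C \<noteq> {}\<close> C(1) psubset.prems(1) by blast+
    ultimately have IH: "fits D u (\<lambda>v. if v \<in> R - C then 1 else 0) (card (R - C) * (2 ^ card D + 1))"
      using psubset.IH[of "R - C"] by simp
    have "fits D u (\<lambda>v. if v \<in> C then 1 else 0) 1"
    proof (rule fits_circuit[OF _ D])
      show "C \<subseteq> D - {u}" using C(1) psubset.prems(1) by simp
      show "zero_sum_circuit ((+) u ` C)" using W(2) C(2) by simp
    qed
    from fits_add[OF IH this]
    have "fits D u (\<lambda>v. if v \<in> R then 1 else 0) (card (R - C) * (2 ^ card D + 1) + 1 + 2 ^ card D)"
      by (rule back_subst[where P = "\<lambda>f. fits D u f _"]) (use C(1) in \<open>auto simp: fun_eq_iff\<close>)
    moreover have "card (R - C) * (2 ^ card D + 1) + 1 + 2 ^ card D \<le> card R * (2 ^ card D + 1)"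
    proof -
      have "card R = card (R - C) + card C"
        using C by (simp add: card_Diff_subset card_mono)
      moreover have "card C \<ge> 1" using \<open>C \<noteq> {}\<close> by (simp add: Suc_le_eq card_gt_0_iff)
      ultimately have "card R \<ge> card (R - C) + 1" by simp
      then have "(card (R - C) + 1) * (2 ^ card D + 1) \<le> card R * (2 ^ card D + 1)"
        by (rule mult_le_mono1)
      then show ?thesis by (simp add: algebra_simps)
    qed
    ultimately show ?thesis by (auto simp: fits_def)
  qed
qed

lemma fits_add_evens:
  fixes D :: "'a::boolean_group set"
  assumes D: "u \<in> D" "0 \<notin> D" and "F \<subseteq> D - {u}" and f: "fits D u f s"
  shows "fits D u (\<lambda>v. f v + (if v \<in> F then 2 * q v else 0)) (s + (\<Sum>v\<in>F. 4 * q v + 2 ^ card D))"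
  using finite[of F] assms(3)
proof (induction F rule: finite_induct)
  case (insert w F)
  have w: "w \<in> D" "w \<noteq> u" "w \<noteq> 0" "u \<noteq> 0" using insert.prems D by auto
  have "fits D u (\<lambda>v. if v = w then 2 * q w else 0) (4 * q w)"
    using w D by (intro fits_even) auto
  from fits_add[OF insert.IH this]
  have "fits D u (\<lambda>v. f v + (if v \<in> insert w F then 2 * q v else 0))
          (s + (\<Sum>v\<in>F. 4 * q v + 2 ^ card D) + 4 * q w + 2 ^ card D)"
    using insert by (auto elim!: back_subst[where P = "\<lambda>f. fits D u f _"])
  then show ?case using insert by (simp add: algebra_simps)
qed (use f in simp)

text \<open>
  Each value other than \<open>u\<close> wastes at most one orbit for its even part, and at most one more for
  its odd part. The single points that the minimal zero-sum sets ask for are paid for by the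
  points saved when \<open>c v\<close> is rounded down to an even number.
\<close>
lemma fits_multiplicities:
  fixes D :: "'a::boolean_group set" and c :: "'a \<Rightarrow> nat"
  assumes D: "u \<in> D" "0 \<notin> D" and R: "R = {v \<in> D - {u}. odd (c v)}" "\<Sum>((+) u ` R) = 0"
    and c: "\<And>v. v \<notin> D \<Longrightarrow> c v = 0"
  shows "fits D u (c(u := 0)) ((\<Sum>v\<in>D-{u}. 2 * c v) + 2 * (card D - 1) * 2 ^ card D)"
proof -
  let ?L = "2 ^ card D :: nat"
  have "R \<subseteq> D - {u}" using R by auto
  from fits_add_evens[OF D order.refl fits_zero_sum[OF D this R(2)], of "\<lambda>v. c v div 2"]
  have "fits D u (c(u := 0)) (card R * (?L + 1) + (\<Sum>v\<in>D-{u}. 4 * (c v div 2) + ?L))"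
    by (rule back_subst[where P = "\<lambda>f. fits D u f _"]) (auto simp: R c fun_eq_iff)
  moreover have "card R * (?L + 1) + (\<Sum>v\<in>D-{u}. 4 * (c v div 2) + ?L)
      \<le> (\<Sum>v\<in>D-{u}. 2 * c v) + 2 * (card D - 1) * ?L"
  proof -
    have "(\<Sum>v\<in>D-{u}. 2 * c v) = (\<Sum>v\<in>D-{u}. 4 * (c v div 2) + (if v \<in> R then 2 else 0))"
      by (intro sum.cong refl) (auto simp: R elim!: oddE)
    also have "\<dots> = (\<Sum>v\<in>D-{u}. 4 * (c v div 2)) + 2 * card R"
      using \<open>R \<subseteq> D - {u}\<close> by (simp add: sum.distrib sum.If_cases Int_absorb1)
    finally have 1: "(\<Sum>v\<in>D-{u}. 2 * c v) = (\<Sum>v\<in>D-{u}. 4 * (c v div 2)) + 2 * card R" .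
    have cD: "card (D - {u}) = card D - 1" using D by simp
    have "card R \<le> card D - 1" using card_mono[OF _ \<open>R \<subseteq> D - {u}\<close>] cD by simp
    then have "card R * ?L \<le> (card D - 1) * ?L" by (rule mult_le_mono1)
    then show ?thesis unfolding 1 by (simp add: sum.distrib cD algebra_simps)
  qed
  ultimately show ?thesis unfolding fits_def by (meson le_trans)
qed

section \<open>Indexed families of differences\<close>

lemma sum_constant_parity: "(\<Sum>i\<in>A. u) = (if even (card A) then 0 else (u :: 'a::boolean_group))"
  by (induction A rule: infinite_finite_induct) auto

lemma sum_fibres_parity:
  fixes d :: "'i \<Rightarrow> 'a::boolean_group"
  assumes "finite I"
  shows "sum d I = \<Sum>{v. odd (card {i \<in> I. d i = v})}"
proof -
  have "sum d I = (\<Sum>v\<in>UNIV. \<Sum>i\<in>{i \<in> I. d i = v}. d i)"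
    using assms by (intro sum.group[symmetric]) auto
  also have "\<dots> = (\<Sum>v\<in>UNIV. \<Sum>i\<in>{i \<in> I. d i = v}. v)"
    by (intro sum.cong) auto
  also have "\<dots> = \<Sum>{v. odd (card {i \<in> I. d i = v})}"
    by (simp add: sum_constant_parity sum.If_cases Collect_neg_eq[symmetric])
  finally show ?thesis .
qed

lemma ex_frequent_value:
  assumes "finite I" "I \<noteq> {}"
  obtains u where "u \<in> d ` I" "card I \<le> card (d ` I) * card {i \<in> I. d i = u}"
proof -
  let ?c = "\<lambda>v. card {i \<in> I. d i = v}"
  have "Max (?c ` d ` I) \<in> ?c ` d ` I" using assms by (intro Max_in) auto
  then obtain u where u: "u \<in> d ` I" "Max (?c ` d ` I) = ?c u" by auto
  have "card I = (\<Sum>v\<in>d ` I. ?c v)"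
    using sum.group[OF assms(1), of "d ` I" d "\<lambda>_. 1::nat"] assms by simp
  also have "\<dots> \<le> card (d ` I) * ?c u"
  proof -
    have "?c v \<le> ?c u" if "v \<in> d ` I" for v
      unfolding u(2)[symmetric] using that assms(1) by (intro Max_ge) auto
    from sum_bounded_above[of "d ` I" ?c, OF this] show ?thesis by simp
  qed
  finally show thesis using that u by blast
qed

text \<open>
  An arbitrary numbering \<open>e\<close> of the group selects the smaller point of each pair. For each
  value \<open>v\<close>, the selected points of pairs with difference \<open>v\<close> are as many as the indices \<open>i\<close>
  with \<open>d i = v\<close>, and any bijection between them labels the pairs.
\<close>
lemma pairing_from_matching:
  fixes d :: "'i \<Rightarrow> 'a::boolean_group"
  assumes I: "finite I" and nz: "\<forall>i\<in>I. d i \<noteq> 0"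
    and g: "\<And>x. g (x + g x) = g x"
    and count: "\<And>v. card {x. g x = v} = 2 * card {i \<in> I. d i = v}"
  obtains a where "disjoint_family_on (\<lambda>i. {a i, a i + d i}) I" "(\<Union>i\<in>I. {a i, a i + d i}) = UNIV"
proof -
  obtain e :: "'a \<Rightarrow> nat" where e: "inj e"
    using finite_imp_inj_to_nat_seg[OF finite[of "UNIV :: 'a set"]] by auto
  define R where "R v = {x. g x = v \<and> e x < e (x + v)}" for v
  have gv: "g (x + v) = v" if "g x = v" for x v using g[of x] that by simp
  have R_total: "x \<in> R v \<or> x + v \<in> R v" if "g x = v" "v \<noteq> 0" for x v
  proof -
    have "e x \<noteq> e (x + v)" using that e by (simp add: inj_eq)
    then show ?thesis using that gv by (auto simp: R_def add.assoc)
  qed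
  have card_R: "card {i \<in> I. d i = v} = card (R v)" if v: "v \<noteq> 0" for v
  proof -
    have "{x. g x = v} = R v \<union> (\<lambda>x. x + v) ` R v"
    proof (intro equalityI subsetI)
      fix x assume "x \<in> {x. g x = v}"
      then show "x \<in> R v \<union> (\<lambda>x. x + v) ` R v"
        using R_total[of x v] v by (auto intro!: image_eqI[of _ _ "x + v"] simp: add.assoc)
    qed (auto simp: R_def gv)
    moreover have "R v \<inter> (\<lambda>x. x + v) ` R v = {}" by (auto simp: R_def add.assoc)
    moreover have "card ((\<lambda>x. x + v) ` R v) = card (R v)" by (simp add: card_image)
    ultimately show ?thesis using count[of v] by (simp add: card_Un_disjoint)
  qed
  have "\<exists>h. bij_betw h {i \<in> I. d i = v} (R v)" if "v \<noteq> 0" for v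
    using I card_R[OF that] by (intro finite_same_card_bij) auto
  then obtain h where h: "\<And>v. v \<noteq> 0 \<Longrightarrow> bij_betw (h v) {i \<in> I. d i = v} (R v)"
    by metis
  define a where "a i = h (d i) i" for i
  have a: "a i \<in> R (d i)" if "i \<in> I" for i
    using bij_betwE[OF h[of "d i"]] that nz by (auto simp: a_def)
  show thesis
  proof (rule that)
    show "disjoint_family_on (\<lambda>i. {a i, a i + d i}) I"
      unfolding disjoint_family_on_def
    proof (intro ballI impI, rule ccontr)
      fix i j assume ij: "i \<in> I" "j \<in> I" "i \<noteq> j" "{a i, a i + d i} \<inter> {a j, a j + d j} \<noteq> {}"
      have gd: "g y = d l" if "y \<in> {a l, a l + d l}" "l \<in> I" for y l
        using that(1) a[OF that(2)] gv[of "a l" "d l"]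
        by (elim insertE emptyE) (simp_all add: R_def)
      obtain x where x: "x \<in> {a i, a i + d i}" "x \<in> {a j, a j + d j}"
        using ij(4) by blast
      have d: "d i = d j"
        using gd[OF x(1) ij(1)] gd[OF x(2) ij(2)] by simp
      have "inj_on (h (d j)) {l \<in> I. d l = d j}"
        using h[of "d j"] nz ij(2) by (simp add: bij_betw_def)
      then have "a i \<noteq> a j"
        using ij(1-3) d by (simp add: a_def inj_on_eq_iff)
      then have "a i = a j + d j \<or> a i + d j = a j"
        using x unfolding d by (elim insertE emptyE) simp_all
      then have eq: "a i = a j + d j"
        by (metis add_self_left add.commute)
      with a[OF ij(1)] a[OF ij(2)] show False
        by (simp add: R_def d add.assoc)
    qed
    show "(\<Union>i\<in>I. {a i, a i + d i}) = UNIV"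
    proof (intro equalityI subsetI)
      fix x
      have none: "{i \<in> I. d i = 0} = {}" using nz by auto
      have "card {x. g x = 0} = 0" unfolding count none by simp
      then have v: "g x \<noteq> 0" by auto
      have "\<exists>i\<in>I. d i = g x \<and> a i = y" if "y \<in> R (g x)" for y
      proof -
        have "y \<in> h (g x) ` {i \<in> I. d i = g x}"
          using that h[OF v] by (simp add: bij_betw_def)
        then show ?thesis by (auto simp: a_def)
      qed
      with R_total[OF refl v] show "x \<in> (\<Union>i\<in>I. {a i, a i + d i})"
        by (force simp: add.assoc)
    qed simp
  qed
qed

section \<open>The pairing theorem\<close>

text \<open>
  The size condition guarantees that a most frequent value \<open>u\<close> occurs often enough to fill all
  the space that the packing wastes.
\<close>
theorem boolean_group_pairing:
  fixes d :: "'i \<Rightarrow> 'a::boolean_group"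
  assumes I: "finite I" "I \<noteq> {}" "even (card I)" "CARD('a) = 2 * card I"
    and nz: "\<forall>i\<in>I. d i \<noteq> 0" and sum0: "sum d I = 0"
    and few: "card (d ` I) * ((card (d ` I) - 1) * 2 ^ card (d ` I)) \<le> card I"
  obtains a where "disjoint_family_on (\<lambda>i. {a i, a i + d i}) I" "(\<Union>i\<in>I. {a i, a i + d i}) = UNIV"
proof -
  define D where "D = d ` I"
  define c where "c v = card {i \<in> I. d i = v}" for v
  obtain u where u: "u \<in> D" "card I \<le> card D * c u"
    using ex_frequent_value[OF I(1,2), of d] unfolding D_def c_def by blast
  have D0: "0 \<notin> D" using nz by (auto simp: D_def)
  have cD: "c v = 0" if "v \<notin> D" for v using that I(1) by (auto simp: c_def D_def)
  have sum_c: "sum c UNIV = card I"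
    unfolding c_def using sum.group[OF I(1), of UNIV d "\<lambda>_. 1::nat"] by simp
  have "card D > 0" using u(1) by (auto simp: card_gt_0_iff)
  moreover have "card D * ((card D - 1) * 2 ^ card D) \<le> card D * c u"
    using few u(2) unfolding D_def by linarith
  ultimately have cu: "(card D - 1) * 2 ^ card D \<le> c u" by simp

  define R where "R = {v \<in> D - {u}. odd (c v)}"
  have R: "R = {v. odd (c v)} - {u}" using cD by (fastforce simp: R_def)
  have odd_sum: "\<Sum>{v. odd (c v)} = 0"
    using sum0 sum_fibres_parity[OF I(1), of d] by (simp add: c_def)
  have odd_card: "even (card {v. odd (c v)})"
    using even_sum_iff[of UNIV c] sum_c I(3) by simp
  \<comment> \<open>If \<open>u\<close> has odd multiplicity, then \<open>card R\<close> is odd and \<open>\<Sum>R = u\<close>; otherwise \<open>card R\<close> is even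
    and \<open>\<Sum>R = 0\<close>. Shifting by \<open>u\<close> gives sum zero in both cases.\<close>
  have "\<Sum>((+) u ` R) = (\<Sum>v\<in>R. u) + \<Sum>R"
    by (subst sum.reindex) (simp_all only: inj_on_add sum.distrib o_def)
  also have "\<dots> = 0"
  proof (cases "odd (c u)")
    case True
    then have "u \<in> {v. odd (c v)}" by simp
    then have "card {v. odd (c v)} = Suc (card R)" "\<Sum>{v. odd (c v)} = u + \<Sum>R"
      unfolding R by (rule card.remove[OF finite], rule sum.remove[OF finite])
    with odd_sum odd_card show ?thesis by (simp add: sum_constant_parity)
  next
    case False
    then have "R = {v. odd (c v)}" by (auto simp: R)
    with odd_sum odd_card show ?thesis by (simp add: sum_constant_parity)
  qed
  finally have Rsum: "\<Sum>((+) u ` R) = 0" .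

  have sum_u: "card I = c u + (\<Sum>v\<in>D-{u}. c v)"
  proof -
    have "sum c UNIV = sum c D" using cD by (intro sum.mono_neutral_right) auto
    then show ?thesis using sum_c sum.remove[of D u c] u by simp
  qed
  have "(\<Sum>v\<in>D-{u}. 2 * c v) + 2 * (card D - 1) * 2 ^ card D \<le> card (UNIV :: 'a set)"
    using sum_u cu I(4) by (simp flip: sum_distrib_left)
  then obtain g where g: "matching_on u UNIV (c(u := 0)) g"
    using fits_multiplicities[OF u(1) D0 R_def Rsum cD] closed_under_UNIV
    unfolding fits_def by blast
  have other: "card {x. g x = v} = 2 * c v" if "v \<noteq> u" for v
    using g that by (simp add: matching_on_def)
  \<comment> \<open>The filler has the right multiplicity because all the others do.\<close>
  have "card {x. g x = u} = 2 * c u"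
  proof -
    have "2 * card I = (\<Sum>v\<in>UNIV. card {x. g x = v})"
      using sum.group[of UNIV UNIV g "\<lambda>_. 1::nat"] I(4) by simp
    also have "\<dots> = card {x. g x = u} + (\<Sum>v\<in>UNIV-{u}. 2 * c v)"
      by (subst sum.remove[of _ u]) (auto simp: other)
    also have "(\<Sum>v\<in>UNIV-{u}. 2 * c v) = 2 * (card I - c u)"
      using sum_c sum.remove[of UNIV u c] by (simp flip: sum_distrib_left)
    finally show ?thesis using sum_u by simp
  qed
  with other have count: "card {x. g x = v} = 2 * card {i \<in> I. d i = v}" for v
    unfolding c_def by (cases "v = u") simp_all
  have "g (x + g x) = g x" for x using g unfolding matching_on_def by blast
  from pairing_from_matching[OF I(1) nz this count] that show thesis by blast
qed

text \<open>
  The hypothesis amounts to \<open>n\<^sup>2 \<le> 2\<^sup>n\<^sup>-\<^sup>1\<^sup>-\<^sup>k\<close>, and \<open>k (k - 1) \<le> n\<^sup>2\<close>;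
  hence \<open>k (k - 1) 2\<^sup>k \<le> 2\<^sup>n\<^sup>-\<^sup>1 = m\<close>.
\<close>
theorem theorem1p8:
  fixes n m :: nat and d :: "nat \<Rightarrow> bit ^ 'n::finite"
  assumes "n = CARD('n)" and "n \<ge> 2" and "m = 2 ^ (n - 1)"
    and "\<forall>i\<in>{1..m}. d i \<noteq> 0"
    and "(\<Sum>i=1..m. d i) = 0"
    and "real (card (d ` {1..m})) \<le> real n - 2 * log 2 (real n) - 1"
  shows "\<exists>a b :: nat \<Rightarrow> bit ^ 'n.
           disjoint_family_on (\<lambda>i. {a i, b i}) {1..m} \<and>
           (\<Union>i\<in>{1..m}. {a i, b i}) = UNIV \<and>
           (\<forall>i\<in>{1..m}. a i \<noteq> b i \<and> a i - b i = d i)"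
proof -
  define k where "k = card (d ` {1..m})"
  have bound: "real k + 2 * log 2 (real n) + 1 \<le> real n" using assms(6) by (simp add: k_def)
  have log_nonneg: "0 \<le> log 2 (real n)" using assms(2) by simp
  have kn: "k + 1 \<le> n" using bound log_nonneg by linarith
  have "2 powr log 2 (real n) = real n" using assms(2) by simp
  then have "real n ^ 2 = 2 powr (2 * log 2 (real n))"
    by (simp only: mult_2 powr_add power2_eq_square)
  also have "\<dots> \<le> 2 powr real (n - 1 - k)"
    using bound kn by (intro powr_mono) (auto simp: of_nat_diff)
  also have "\<dots> = real (2 ^ (n - 1 - k))" by (simp add: powr_realpow)
  finally have "n ^ 2 \<le> 2 ^ (n - 1 - k)"
    by (metis of_nat_le_iff of_nat_power)
  moreover have "k * (k - 1) \<le> n ^ 2"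
    unfolding power2_eq_square using kn by (intro mult_le_mono) auto
  ultimately have "k * (k - 1) * 2 ^ k \<le> 2 ^ (n - 1 - k) * 2 ^ k"
    by (intro mult_le_mono1) linarith
  also have "\<dots> = m" using kn assms(3) by (simp flip: power_add)
  finally have few: "k * ((k - 1) * 2 ^ k) \<le> card {1..m}" by (simp add: mult.assoc)
  have "even m" using assms(2,3) by auto
  moreover have "CARD(bit ^ 'n) = 2 * m"
  proof -
    have "(UNIV :: bit set) = {0, 1}" by (auto intro: bit.exhaust)
    then have "CARD(bit) = card {0, 1 :: bit}" by (rule arg_cong)
    then show ?thesis using assms(1-3) by (simp add: numeral_2_eq_2 flip: power_Suc)
  qed
  moreover have "{1..m} \<noteq> {}" using assms(3) by simp
  ultimately obtain a where a: "disjoint_family_on (\<lambda>i. {a i, a i + d i}) {1..m}"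
      "(\<Union>i\<in>{1..m}. {a i, a i + d i}) = UNIV"
    using boolean_group_pairing[of "{1..m}" d] assms(4,5) few by (auto simp: k_def)
  show ?thesis
    by (rule exI[of _ a], rule exI[of _ "\<lambda>i. a i + d i"])
       (use a assms(4) in \<open>simp add: diff_conv_add\<close>)
qed

end
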